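(* Let $t$ with $1\le t\le g$ be such that the Gram-Schmidt process $$\boldsymbol q_1=\frac{\boldsymbol v_1}{\|\boldsymbol v_1\|_G},\qquad \boldsymbol q_i=\frac{\mathbf X_{u_i}^{(2)}\boldsymbol v_{s_i}-\sum_{k=1}^{i-1}\boldsymbol q_k\,\langle \mathbf X_{u_i}^{(2)}\boldsymbol v_{s_i},\boldsymbol q_k\rangle_G}{\left\|\mathbf X_{u_i}^{(2)}\boldsymbol v_{s_i}-\sum_{k=1}^{i-1}\boldsymbol q_k\,\langle \mathbf X_{u_i}^{(2)}\boldsymbol v_{s_i},\boldsymbol q_k\rangle_G\right\|_G}\quad(i\ge 2)$$ proceeds for $t$ steps without breakdown, i.e. all the denominators occurring in the formulas for $\boldsymbol q_1,\dots,\boldsymbol q_t$ are nonzero. Let $\widehat{\boldsymbol q}_i$ be computed recursively by $$\widehat{\boldsymbol q}_1=\boldsymbol q_1,\qquad \widehat{\boldsymbol q}_i=\frac{\mathbf X_{u_i}^{(2)}\widehat{\boldsymbol q}_{s_i}-\sum_{k=1}^{i-1}\widehat{\boldsymbol q}_k\,\langle \mathbf X_{u_i}^{(2)}\widehat{\boldsymbol q}_{s_i},\widehat{\boldsymbol q}_k\rangle_G}{\left\|\mathbf X_{u_i}^{(2)}\widehat{\boldsymbol q}_{s_i}-\sum_{k=1}^{i-1}\widehat{\boldsymbol q}_k\,\langle \mathbf X_{u_i}^{(2)}\widehat{\boldsymbol q}_{s_i},\widehat{\boldsymbol q}_k\rangle_G\right\|_G}\quad(i\ge 2).$$ Then $\boldsymbol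 q_i=\widehat{\boldsymbol q}_i$ for every $1\le i\le t$.
   Context: Write $[d]=\{1,\dots,d\}$. Fix integers $d\ge1$, $n\ge 1$, $m\ge1$. For a multi-index $\boldsymbol\alpha\in\mathbb N^d$ (nonnegative integer entries $[\boldsymbol\alpha]_1,\dots,[\boldsymbol\alpha]_d$) put $|\boldsymbol\alpha|=\sum_j[\boldsymbol\alpha]_j$ and $\boldsymbol x^{\boldsymbol\alpha}=\prod_{j=1}^d x_j^{[\boldsymbol\alpha]_j}$. Let $\mathbb P_n^{d,\mathrm{tol}}=\mathrm{span}\{\boldsymbol x^{\boldsymbol\alpha}:|\boldsymbol\alpha|\le n\}$ be the space of real polynomials in $d$ variables of total degree at most $n$, with dimension $g=\binom{n+d}{d}$. Let $\varphi_1,\dots,\varphi_g$ be the monomials of total degree at most $n$ listed in the following ordering (called "grevlex" in the paper): $\boldsymbol x^{\boldsymbol\alpha}$ appears before $\boldsymbol x^{\widetilde{\boldsymbol\alpha}}$ if either $|\boldsymbol\alpha|<|\widetilde{\boldsymbol\alpha}|$, or $|\boldsymbol\alpha|=|\widetilde{\boldsymbol\alpha}|$ and there is $k\ge1$ with $[\boldsymbol\alpha]_j=[\widetilde{\boldsymbol\alpha}]_j$ for $1\le j\le k-1$ and $[\boldsymbol\alpha]_k>[\widetilde{\boldsymbol\alpha}]_k$. For each $2\le i\le g$, let $s_i$ (which satisfies $s_i<i$) be the smallest index such that there exists $u_i\in[d]$ with $\varphi_i(\boldsymbol x)=x_{u_i}\varphi_{s_i}(\boldsymbol x)$; $u_i$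 denotes the corresponding variable index. Let $\boldsymbol x_1,\dots,\boldsymbol x_m\in\mathbb R^d$ be given nodes and $\widetilde d=1+d+d(d+1)/2$. Vectors in $\mathbb R^{m\widetilde d}$ are partitioned into blocks of length $m$: a block $w_0$, blocks $w_1,\dots,w_d$, and blocks $w_{j,k}$ for $1\le j\le k\le d$ (in the order $(1,1),(1,2),\dots,(1,d),(2,2),\dots,(d,d)$). For $1\le i\le g$, the vector $\boldsymbol v_i\in\mathbb R^{m\widetilde d}$ has blocks $w_0=[\varphi_i(\boldsymbol x_1),\dots,\varphi_i(\boldsymbol x_m)]^{T}$, $w_j=[\partial_j\varphi_i(\boldsymbol x_1),\dots,\partial_j\varphi_i(\boldsymbol x_m)]^{T}$ and $w_{j,k}=[\partial_{j,k}\varphi_i(\boldsymbol x_1),\dots,\partial_{j,k}\varphi_i(\boldsymbol x_m)]^{T}$, where $\partial_j=\partial/\partial x_j$ and $\partial_{j,k}=\partial^2/\partial x_j\partial x_k$. For $u\in[d]$, let $X_u=\mathrm{diag}([\boldsymbol x_1]_u,\dots,[\boldsymbol x_m]_u)\in\mathbb R^{m\times m}$, where $[\boldsymbol x_l]_u$ is the $u$-th entry of the node $\boldsymbol x_l$. The matrix $\mathbf X_u^{(2)}\in\mathbb R^{m\widetilde d\times m\widetilde d}$ is the linear map sending a vector with blocks $(w_0,(w_j)_j,(w_{j,k})_{j\le k})$ to the vector with blocks $$X_uw_0,\qquad \delta_{u,j}\,w_0+X_uw_j\ (1\le j\le d),\qquad \delta_{u,j}\,w_k+\delta_{u,k}\,w_j+X_uw_{j,k}\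 (1\le j\le k\le d),$$ where $\delta$ is the Kronecker delta. Let $G\in\mathbb R^{m\widetilde d\times m\widetilde d}$ be a symmetric positive semidefinite matrix (possibly singular), and let $\langle\boldsymbol x,\boldsymbol y\rangle_G=\boldsymbol x^{T}G\boldsymbol y$ and $\|\boldsymbol x\|_G=\sqrt{\langle\boldsymbol x,\boldsymbol x\rangle_G}$. *)

theory Defs
  imports "HOL-Analysis.Derivative" "Jordan_Normal_Form.Matrix"
begin

unbundle no vec_syntax
no_notation inner (infix \<open>\<bullet>\<close> 70)

text \<open>
  Coordinates, nodes and basis functions are numbered from 1, as in the mathematics. A point of
  \<open>\<real>\<^sup>d\<close> is a function \<open>nat \<Rightarrow> real\<close> and a multi-index a function \<open>nat \<Rightarrow> nat\<close>; only the
  arguments in \<open>{1..d}\<close> are meaningful. Multi-indices are required to vanish elsewhere, so that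
  each one has a single representation.
\<close>

definition mdeg :: "nat \<Rightarrow> (nat \<Rightarrow> nat) \<Rightarrow> nat" where
  "mdeg d \<alpha> = (\<Sum>j=1..d. \<alpha> j)"

definition multi_indices :: "nat \<Rightarrow> nat \<Rightarrow> (nat \<Rightarrow> nat) set" where
  "multi_indices d n = {\<alpha>. (\<forall>j. j \<notin> {1..d} \<longrightarrow> \<alpha> j = 0) \<and> mdeg d \<alpha> \<le> n}"

definition monomial :: "nat \<Rightarrow> (nat \<Rightarrow> nat) \<Rightarrow> (nat \<Rightarrow> real) \<Rightarrow> real" where
  "monomial d \<alpha> x = (\<Prod>j=1..d. x j ^ \<alpha> j)"

definition grevlex_less :: "nat \<Rightarrow> (nat \<Rightarrow> nat) \<Rightarrow> (nat \<Rightarrow> nat) \<Rightarrow> bool" where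
  "grevlex_less d \<alpha> \<beta> \<longleftrightarrow>
     mdeg d \<alpha> < mdeg d \<beta> \<or>
     mdeg d \<alpha> = mdeg d \<beta> \<and> (\<exists>k\<in>{1..d}. (\<forall>j\<in>{1..<k}. \<alpha> j = \<beta> j) \<and> \<alpha> k > \<beta> k)"

text \<open>The order is strict and total on \<open>multi_indices d n\<close>, so this list exists, is unique and has
  no repetitions.\<close>

definition grevlex_list :: "nat \<Rightarrow> nat \<Rightarrow> (nat \<Rightarrow> nat) list" where
  "grevlex_list d n =
     (THE as. sorted_wrt (grevlex_less d) as \<and> set as = multi_indices d n)"

definition phi :: "nat \<Rightarrow> nat \<Rightarrow> nat \<Rightarrow> (nat \<Rightarrow> real) \<Rightarrow> real" where
  "phi d n i = monomial d (grevlex_list d n ! (i - 1))"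

definition dim_poly :: "nat \<Rightarrow> nat \<Rightarrow> nat" where
  "dim_poly d n = (n + d) choose d"

definition s_idx :: "nat \<Rightarrow> nat \<Rightarrow> nat \<Rightarrow> nat" where
  "s_idx d n i =
     (LEAST s. s \<in> {1..dim_poly d n} \<and> (\<exists>u\<in>{1..d}. \<forall>x. phi d n i x = x u * phi d n s x))"

definition u_idx :: "nat \<Rightarrow> nat \<Rightarrow> nat \<Rightarrow> nat" where
  "u_idx d n i =
     (THE u. u \<in> {1..d} \<and> (\<forall>x. phi d n i x = x u * phi d n (s_idx d n i) x))"

definition pderiv_at :: "nat \<Rightarrow> ((nat \<Rightarrow> real) \<Rightarrow> real) \<Rightarrow> (nat \<Rightarrow> real) \<Rightarrow> real" where
  "pderiv_at j f x = deriv (\<lambda>y. f (x(j := y))) (x j)"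

text \<open>Labels of the blocks: \<open>Val\<close> for \<open>w\<^sub>0\<close>, \<open>D1 j\<close> for \<open>w\<^sub>j\<close> and
  \<open>D2 j k\<close> (used for \<open>j \<le> k\<close> only) for \<open>w\<close> with index pair \<open>j, k\<close>.\<close>

datatype block = Val | D1 nat | D2 nat nat

definition blocks :: "nat \<Rightarrow> block list" where
  "blocks d = Val # map D1 [1..<d+1] @ concat (map (\<lambda>j. map (D2 j) [j..<d+1]) [1..<d+1])"

definition dim_jet :: "nat \<Rightarrow> nat" where
  "dim_jet d = 1 + d + d * (d + 1) div 2"

definition block_pos :: "nat \<Rightarrow> block \<Rightarrow> nat" where
  "block_pos d b = (THE p. p < dim_jet d \<and> blocks d ! p = b)"

text \<open>Entry \<open>l \<in> {1..m}\<close> of block \<open>b\<close> of \<open>w\<close>, and conversely the vector whose block \<open>b\<close> has the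
  entries \<open>W b l\<close>.\<close>

definition entry :: "nat \<Rightarrow> nat \<Rightarrow> real vec \<Rightarrow> block \<Rightarrow> nat \<Rightarrow> real" where
  "entry d m w b l = w $ (m * block_pos d b + (l - 1))"

definition stack :: "nat \<Rightarrow> nat \<Rightarrow> (block \<Rightarrow> nat \<Rightarrow> real) \<Rightarrow> real vec" where
  "stack d m W = vec (m * dim_jet d) (\<lambda>r. W (blocks d ! (r div m)) (r mod m + 1))"

definition v_vec :: "nat \<Rightarrow> nat \<Rightarrow> nat \<Rightarrow> (nat \<Rightarrow> nat \<Rightarrow> real) \<Rightarrow> nat \<Rightarrow> real vec" where
  "v_vec d n m x i = stack d m (\<lambda>b l. case b of
       Val \<Rightarrow> phi d n i (x l)
     | D1 j \<Rightarrow> pderiv_at j (phi d n i) (x l)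
     | D2 j k \<Rightarrow> pderiv_at j (pderiv_at k (phi d n i)) (x l))"

definition kron :: "nat \<Rightarrow> nat \<Rightarrow> real" where
  "kron a b = (if a = b then 1 else 0)"

definition X2_map :: "nat \<Rightarrow> nat \<Rightarrow> (nat \<Rightarrow> nat \<Rightarrow> real) \<Rightarrow> nat \<Rightarrow> real vec \<Rightarrow> real vec" where
  "X2_map d m x u w = stack d m (\<lambda>b l. case b of
       Val \<Rightarrow> x l u * entry d m w Val l
     | D1 j \<Rightarrow> kron u j * entry d m w Val l + x l u * entry d m w (D1 j) l
     | D2 j k \<Rightarrow> kron u j * entry d m w (D1 k) l + kron u k * entry d m w (D1 j) l
                + x l u * entry d m w (D2 j k) l)"

text \<open>The matrix of the linear map \<open>X2_map d m x u\<close>: column \<open>c\<close> is the image of the \<open>c\<close>-th unit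
  vector.\<close>

definition X2_mat :: "nat \<Rightarrow> nat \<Rightarrow> (nat \<Rightarrow> nat \<Rightarrow> real) \<Rightarrow> nat \<Rightarrow> real mat" where
  "X2_mat d m x u = mat (m * dim_jet d) (m * dim_jet d)
     (\<lambda>(r, c). X2_map d m x u (unit_vec (m * dim_jet d) c) $ r)"

definition sym_psd_mat :: "nat \<Rightarrow> real mat \<Rightarrow> bool" where
  "sym_psd_mat N G \<longleftrightarrow>
     G \<in> carrier_mat N N \<and> transpose_mat G = G \<and>
     (\<forall>w\<in>carrier_vec N. w \<bullet> (G *\<^sub>v w) \<ge> 0)"

definition inner_G :: "real mat \<Rightarrow> real vec \<Rightarrow> real vec \<Rightarrow> real" where
  "inner_G G v w = v \<bullet> (G *\<^sub>v w)"

definition norm_G :: "real mat \<Rightarrow> real vec \<Rightarrow> real" where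
  "norm_G G v = sqrt (inner_G G v v)"

definition gs_residual :: "real mat \<Rightarrow> (nat \<Rightarrow> real vec) \<Rightarrow> nat \<Rightarrow> real vec \<Rightarrow> real vec" where
  "gs_residual G q i w =
     w - finsum_vec TYPE(real) (dim_vec w) (\<lambda>k. inner_G G w (q k) \<cdot>\<^sub>v q k) {1..<i}"

text \<open>If the norm vanishes, the result is the zero vector (division by zero), which has norm 0.
  Hence an identity with a vector of norm 1 entails that the denominator is nonzero.\<close>

definition normalize_G :: "real mat \<Rightarrow> real vec \<Rightarrow> real vec" where
  "normalize_G G w = (1 / norm_G G w) \<cdot>\<^sub>v w"

end

theory Submission
  imports Defs
begin

text \<open>
  The key identity is \<open>X\<^sub>u v\<^sub>k = v\<^sub>l\<close> whenever \<open>\<phi>\<^sub>l = x\<^sub>u \<phi>\<^sub>k\<close>: the matrix encodes the product rule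
  for first and second derivatives (lemma \<open>X2_mat_v_vec\<close>). Hence the first process is the ordinary
  Gram-Schmidt process for \<open>v\<^sub>1, v\<^sub>2, \<dots>\<close>, and its \<open>q\<^sub>1, \<dots>, q\<^sub>i\<close> span the same space as
  \<open>v\<^sub>1, \<dots>, v\<^sub>i\<close>.

  Put \<open>s = s\<^sub>i\<close> and \<open>u = u\<^sub>i\<close>. Then \<open>q\<^sub>s = c (v\<^sub>s - e)\<close> with \<open>c > 0\<close> and \<open>e\<close> in the span of the
  \<open>v\<^sub>k\<close> with \<open>k < s\<close>. The order on monomials is compatible with multiplication by a variable, so for
  \<open>k < s\<close> the product \<open>x\<^sub>u \<phi>\<^sub>k\<close> is a monomial that precedes \<open>x\<^sub>u \<phi>\<^sub>s = \<phi>\<^sub>i\<close>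
  (lemma \<open>earlier_products_are_earlier\<close>). Therefore \<open>X\<^sub>u e\<close> lies in the span of
  \<open>v\<^sub>1, \<dots>, v\<^sub>i\<^sub>-\<^sub>1\<close>, which is the span of \<open>q\<^sub>1, \<dots>, q\<^sub>i\<^sub>-\<^sub>1\<close>. Orthogonalization against these
  vectors annihilates their span, so \<open>X\<^sub>u q\<^sub>s = c v\<^sub>i - c X\<^sub>u e\<close> and \<open>v\<^sub>i\<close> have residuals that differ by
  the factor \<open>c > 0\<close> only. Normalization removes it, and induction on \<open>i\<close> gives the claim
  (lemma \<open>gram_schmidt_recursive_generation\<close>).

  All these are identities between vectors, not merely up to vectors of norm zero, so a singular
  \<open>G\<close> is covered: by the absence of breakdown, the \<open>q\<^sub>k\<close> are orthonormal also in that case.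
\<close>

section \<open>The monomial order\<close>

lemma grevlex_irrefl: "\<not> grevlex_less d \<alpha> \<alpha>"
  by (auto simp: grevlex_less_def)

lemma grevlex_trans:
  assumes "grevlex_less d \<alpha> \<beta>" "grevlex_less d \<beta> \<gamma>"
  shows "grevlex_less d \<alpha> \<gamma>"
proof (cases "mdeg d \<alpha> = mdeg d \<beta> \<and> mdeg d \<beta> = mdeg d \<gamma>")
  case False
  then show ?thesis using assms unfolding grevlex_less_def by linarith
next
  case True
  then obtain k l where k: "k \<in> {1..d}" "\<forall>j\<in>{1..<k}. \<alpha> j = \<beta> j" "\<alpha> k > \<beta> k"
    and l: "l \<in> {1..d}" "\<forall>j\<in>{1..<l}. \<beta> j = \<gamma> j" "\<beta> l > \<gamma> l"
    using assms unfolding grevlex_less_def by auto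
  have "\<forall>j\<in>{1..<min k l}. \<alpha> j = \<gamma> j" using k(2) l(2) by auto
  moreover have "\<alpha> (min k l) > \<gamma> (min k l)"
  proof (cases k l rule: linorder_cases)
    case less
    then show ?thesis using k l(2)[rule_format, of k] by simp
  next
    case equal
    then show ?thesis using k l by simp
  next
    case greater
    then show ?thesis using l k(2)[rule_format, of l] by simp
  qed
  moreover have "min k l \<in> {1..d}" using k(1) l(1) by auto
  ultimately have "\<exists>k\<in>{1..d}. (\<forall>j\<in>{1..<k}. \<alpha> j = \<gamma> j) \<and> \<alpha> k > \<gamma> k"
    by (intro bexI[of _ "min k l"]) auto
  then show ?thesis using True by (simp add: grevlex_less_def)
qed

text \<open>Two distinct multi-indices are compared at the first coordinate where they differ.\<close>

lemma grevlex_total: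
  assumes "\<alpha> \<in> multi_indices d n" "\<beta> \<in> multi_indices d n'" "\<alpha> \<noteq> \<beta>"
  shows "grevlex_less d \<alpha> \<beta> \<or> grevlex_less d \<beta> \<alpha>"
proof -
  obtain j where j: "\<alpha> j \<noteq> \<beta> j" using assms(3) by auto
  define k where "k = (LEAST j. \<alpha> j \<noteq> \<beta> j)"
  have k: "\<alpha> k \<noteq> \<beta> k" unfolding k_def using j by (rule LeastI)
  have "\<alpha> k = \<beta> k" if "k \<notin> {1..d}"
    using that assms(1,2) unfolding multi_indices_def by simp
  then have "k \<in> {1..d}" using k by blast
  have below: "\<alpha> j = \<beta> j" if "j \<in> {1..<k}" for j
    using that not_less_Least[of j "\<lambda>j. \<alpha> j \<noteq> \<beta> j"] unfolding k_def by force
  have below': "\<forall>j\<in>{1..<k}. \<alpha> j = \<beta> j" "\<forall>j\<in>{1..<k}. \<beta> j = \<alpha> j"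
    using below by auto
  consider "\<alpha> k > \<beta> k" | "\<beta> k > \<alpha> k" using k by linarith
  then have "(\<exists>k\<in>{1..d}. (\<forall>j\<in>{1..<k}. \<alpha> j = \<beta> j) \<and> \<alpha> k > \<beta> k) \<or>
      (\<exists>k\<in>{1..d}. (\<forall>j\<in>{1..<k}. \<beta> j = \<alpha> j) \<and> \<beta> k > \<alpha> k)"
    using below' \<open>k \<in> {1..d}\<close> by cases blast+
  then show ?thesis
    unfolding grevlex_less_def by linarith
qed

text \<open>Insertion of \<open>a\<close> into a sorted list: totality alone says that an entry not below \<open>a\<close> lies
  above it.\<close>

lemma sorted_wrt_list_exists:
  assumes "finite A"
    and trans: "\<And>a b c. \<lbrakk>R a b; R b c\<rbrakk> \<Longrightarrow> R a c"
    and total: "\<And>a b. \<lbrakk>a \<in> A; b \<in> A; a \<noteq> b\<rbrakk> \<Longrightarrow> R a b \<or> R b a"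
  shows "\<exists>xs. sorted_wrt R xs \<and> set xs = A"
  using assms(1) total
proof (induction A)
  case empty
  then show ?case by (intro exI[of _ "[]"]) simp
next
  case (insert a A)
  then obtain xs where xs: "sorted_wrt R xs" "set xs = A" by blast
  let ?ys = "filter (\<lambda>x. R x a) xs @ a # filter (\<lambda>x. \<not> R x a) xs"
  have above: "R a x" if "x \<in> A" "\<not> R x a" for x
    using that insert.hyps insert.prems[of a x] by auto
  have "sorted_wrt R ?ys"
    using xs above by (auto simp: sorted_wrt_append sorted_wrt_filter intro: trans)
  moreover have "set ?ys = insert a A" using xs by auto
  ultimately show ?case by blast
qed

lemma sorted_wrt_irrefl_distinct:
  assumes "\<And>a. \<not> R a a" and "sorted_wrt R xs"
  shows "distinct xs"
  using assms(2) by (induction xs) (use assms(1) in auto)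

lemma sorted_wrt_list_unique:
  assumes irrefl: "\<And>a. \<not> R a a" and trans: "\<And>a b c. \<lbrakk>R a b; R b c\<rbrakk> \<Longrightarrow> R a c"
    and "sorted_wrt R xs" "sorted_wrt R ys" "set xs = set ys"
  shows "xs = ys"
  using assms(3-5)
proof (induction xs arbitrary: ys)
  case Nil
  then show ?case by simp
next
  case (Cons x xs)
  then obtain y zs where ys: "ys = y # zs" by (cases ys) auto
  have "x = y"
  proof (rule ccontr)
    assume "x \<noteq> y"
    then have "x \<in> set zs" "y \<in> set xs" using Cons.prems(3) ys by auto
    then have "R y x" "R x y" using Cons.prems(1,2) ys by auto
    then show False using irrefl trans by blast
  qed
  moreover have "x \<notin> set xs" "y \<notin> set zs" using Cons.prems ys irrefl by auto
  then have "set xs = set zs" using Cons.prems(3) ys \<open>x = y\<close> by auto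
  ultimately show ?case using Cons.IH[of zs] Cons.prems ys by simp
qed

text \<open>Adding the slack \<open>n - |\<alpha>|\<close> as a further entry turns the multi-indices of degree at most \<open>n\<close>
  into the lists of \<open>d + 1\<close> naturals with sum exactly \<open>n\<close>, which stars and bars counts.\<close>

lemma bij_betw_multi_indices:
  "bij_betw (\<lambda>\<alpha>. (n - mdeg d \<alpha>) # map \<alpha> [1..<d+1]) (multi_indices d n)
     {l. length l = d + 1 \<and> sum_list l = n}"
proof (rule bij_betw_byWitness[where f' = "\<lambda>l j. if j \<in> {1..d} then l ! j else 0"])
  have deg: "sum_list (map \<alpha> [1..<d+1]) = mdeg d \<alpha>" for \<alpha> :: "nat \<Rightarrow> nat"
    using interv_sum_list_conv_sum_set_nat[of \<alpha> 1 "d + 1"]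
    by (simp add: mdeg_def atLeastLessThanSuc_atLeastAtMost del: upt_Suc)
  have split: "l = hd l # map ((!) l) [1..<d+1]" if "length l = d + 1" for l :: "nat list"
    using that by (cases l) (auto intro!: nth_equalityI simp: nth_Cons simp del: upt_Suc split: nat.split)
  show "\<forall>\<alpha>\<in>multi_indices d n.
      (\<lambda>j. if j \<in> {1..d} then ((n - mdeg d \<alpha>) # map \<alpha> [1..<d+1]) ! j else 0) = \<alpha>"
    by (auto simp: multi_indices_def fun_eq_iff nth_Cons simp del: upt_Suc split: nat.split)
  show "(\<lambda>\<alpha>. (n - mdeg d \<alpha>) # map \<alpha> [1..<d+1]) ` multi_indices d n
      \<subseteq> {l. length l = d + 1 \<and> sum_list l = n}"
    using deg by (auto simp: multi_indices_def simp del: upt_Suc)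
  show "\<forall>l\<in>{l. length l = d + 1 \<and> sum_list l = n}.
      (n - mdeg d (\<lambda>j. if j \<in> {1..d} then l ! j else 0)) #
        map (\<lambda>j. if j \<in> {1..d} then l ! j else 0) [1..<d+1] = l"
  proof
    fix l :: "nat list" assume l: "l \<in> {l. length l = d + 1 \<and> sum_list l = n}"
    have m: "map (\<lambda>j. if j \<in> {1..d} then l ! j else 0) [1..<d+1] = map ((!) l) [1..<d+1]"
      by (simp del: upt_Suc)
    have "n = hd l + sum_list (map ((!) l) [1..<d+1])"
      using split[of l] l by (metis (mono_tags, lifting) mem_Collect_eq sum_list.Cons)
    then have "n - mdeg d (\<lambda>j. if j \<in> {1..d} then l ! j else 0) = hd l"
      unfolding deg[symmetric] m by simp
    then show "(n - mdeg d (\<lambda>j. if j \<in> {1..d} then l ! j else 0)) #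
        map (\<lambda>j. if j \<in> {1..d} then l ! j else 0) [1..<d+1] = l"
      unfolding m using split[of l] l by simp
  qed
  show "(\<lambda>l j. if j \<in> {1..d} then l ! j else 0) ` {l. length l = d + 1 \<and> sum_list l = n}
      \<subseteq> multi_indices d n"
  proof
    fix \<alpha> assume "\<alpha> \<in> (\<lambda>l j. if j \<in> {1..d} then l ! j else 0) ` {l. length l = d + 1 \<and> sum_list l = n}"
    then obtain l :: "nat list" where l: "length l = d + 1" "sum_list l = n"
      and \<alpha>: "\<alpha> = (\<lambda>j. if j \<in> {1..d} then l ! j else 0)" by auto
    have "map \<alpha> [1..<d+1] = map ((!) l) [1..<d+1]" by (simp add: \<alpha> del: upt_Suc)
    then have "n = hd l + mdeg d \<alpha>"
      using split[of l] l deg[of \<alpha>] by (metis sum_list.Cons)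
    then show "\<alpha> \<in> multi_indices d n" by (auto simp: multi_indices_def \<alpha>)
  qed
qed

lemma card_multi_indices: "card (multi_indices d n) = dim_poly d n"
  using bij_betw_same_card[OF bij_betw_multi_indices[of n d]] card_length_sum_list[of "d + 1" n]
    binomial_symmetric[of n "n + d"]
  by (simp add: dim_poly_def)

lemma finite_multi_indices: "finite (multi_indices d n)"
  by (rule card_ge_0_finite) (simp add: card_multi_indices dim_poly_def)

lemma grevlex_list:
  shows "sorted_wrt (grevlex_less d) (grevlex_list d n)"
    and "set (grevlex_list d n) = multi_indices d n"
proof -
  have "\<exists>!as. sorted_wrt (grevlex_less d) as \<and> set as = multi_indices d n"
  proof (rule ex_ex1I)
    show "\<exists>as. sorted_wrt (grevlex_less d) as \<and> set as = multi_indices d n"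
      by (rule sorted_wrt_list_exists[OF finite_multi_indices grevlex_trans grevlex_total])
    show "as = bs" if "sorted_wrt (grevlex_less d) as \<and> set as = multi_indices d n"
      "sorted_wrt (grevlex_less d) bs \<and> set bs = multi_indices d n" for as bs
      by (rule sorted_wrt_list_unique[where R = "grevlex_less d", OF grevlex_irrefl])
        (use that in \<open>auto elim: grevlex_trans\<close>)
  qed
  from theI'[OF this] show "sorted_wrt (grevlex_less d) (grevlex_list d n)"
    "set (grevlex_list d n) = multi_indices d n"
    unfolding grevlex_list_def by auto
qed

lemma length_grevlex_list: "length (grevlex_list d n) = dim_poly d n"
proof -
  have "distinct (grevlex_list d n)"
    by (rule sorted_wrt_irrefl_distinct[OF grevlex_irrefl grevlex_list(1)])
  from distinct_card[OF this] show ?thesis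
    by (simp add: grevlex_list(2) card_multi_indices)
qed

definition phi_exponent :: "nat \<Rightarrow> nat \<Rightarrow> nat \<Rightarrow> nat \<Rightarrow> nat" where
  "phi_exponent d n i = grevlex_list d n ! (i - 1)"

lemma phi_eq_monomial: "phi d n i = monomial d (phi_exponent d n i)"
  by (simp add: phi_def phi_exponent_def)

lemma phi_exponent_mem:
  assumes "i \<in> {1..dim_poly d n}"
  shows "phi_exponent d n i \<in> multi_indices d n"
proof -
  have "i - 1 < length (grevlex_list d n)" using assms by (auto simp: length_grevlex_list)
  from nth_mem[OF this] show ?thesis by (simp only: phi_exponent_def grevlex_list(2))
qed

lemma phi_exponent_exists:
  assumes "\<alpha> \<in> multi_indices d n"
  obtains i where "i \<in> {1..dim_poly d n}" "\<alpha> = phi_exponent d n i"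
proof -
  obtain p where "p < length (grevlex_list d n)" "\<alpha> = grevlex_list d n ! p"
    using assms unfolding grevlex_list(2)[of d n, symmetric] by (auto simp: in_set_conv_nth)
  then show ?thesis
    by (intro that[of "Suc p"]) (auto simp: phi_exponent_def length_grevlex_list)
qed

text \<open>Sortedness gives one direction, irreflexivity and transitivity the other. The latter recovers the
  position of a product of monomials from its exponents.\<close>

lemma phi_exponent_less_iff:
  assumes "i \<in> {1..dim_poly d n}" "j \<in> {1..dim_poly d n}"
  shows "grevlex_less d (phi_exponent d n i) (phi_exponent d n j) \<longleftrightarrow> i < j"
proof -
  have mono: "grevlex_less d (phi_exponent d n i) (phi_exponent d n j)"
    if "i \<in> {1..dim_poly d n}" "j \<in> {1..dim_poly d n}" "i < j" for i j
  proof -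
    have "i - 1 < j - 1" "j - 1 < length (grevlex_list d n)"
      using that by (auto simp: length_grevlex_list)
    then show ?thesis
      unfolding phi_exponent_def by (rule sorted_wrt_nth_less[OF grevlex_list(1)])
  qed
  show ?thesis
  proof (cases i j rule: linorder_cases)
    case less
    then show ?thesis using mono[OF assms] by simp
  next
    case equal
    then show ?thesis by (simp add: grevlex_irrefl)
  next
    case greater
    then show ?thesis using mono[OF assms(2,1)] grevlex_irrefl[of d "phi_exponent d n i"]
        grevlex_trans[of d "phi_exponent d n i" "phi_exponent d n j" "phi_exponent d n i"] by auto
  qed
qed

section \<open>Multiplication of monomials by a variable\<close>

definition raise :: "nat \<Rightarrow> (nat \<Rightarrow> nat) \<Rightarrow> nat \<Rightarrow> nat" where
  "raise u \<alpha> = \<alpha>(u := \<alpha> u + 1)"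

lemma monomial_raise:
  assumes "u \<in> {1..d}"
  shows "monomial d (raise u \<alpha>) x = x u * monomial d \<alpha> x"
proof -
  have "(\<Prod>j\<in>{1..d} - {u}. x j ^ raise u \<alpha> j) = (\<Prod>j\<in>{1..d} - {u}. x j ^ \<alpha> j)"
    by (rule prod.cong) (auto simp: raise_def)
  moreover have "monomial d \<beta> x = x u ^ \<beta> u * (\<Prod>j\<in>{1..d} - {u}. x j ^ \<beta> j)" for \<beta>
    using assms unfolding monomial_def by (intro prod.remove) auto
  ultimately show ?thesis by (simp add: raise_def)
qed

lemma mdeg_raise:
  assumes "u \<in> {1..d}"
  shows "mdeg d (raise u \<alpha>) = mdeg d \<alpha> + 1"
proof -
  have "(\<Sum>j\<in>{1..d} - {u}. raise u \<alpha> j) = (\<Sum>j\<in>{1..d} - {u}. \<alpha> j)"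
    by (rule sum.cong) (auto simp: raise_def)
  moreover have "mdeg d \<beta> = \<beta> u + (\<Sum>j\<in>{1..d} - {u}. \<beta> j)" for \<beta>
    using assms unfolding mdeg_def by (intro sum.remove) auto
  ultimately show ?thesis by (simp add: raise_def)
qed

text \<open>Both criteria of the order survive the multiplication of both monomials by the same variable:
  both degrees grow by one, and the same coordinate still decides.\<close>

lemma grevlex_raise:
  assumes "u \<in> {1..d}" "grevlex_less d \<alpha> \<beta>"
  shows "grevlex_less d (raise u \<alpha>) (raise u \<beta>)"
  using assms(2) unfolding grevlex_less_def mdeg_raise[OF assms(1)]
  by (auto simp: raise_def)

text \<open>At the point with \<open>j\<close>-th coordinate 2 and all others 1 a monomial takes the value
  \<open>2 ^ \<alpha> j\<close>, so its values determine each exponent.\<close>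

lemma monomial_inj:
  assumes "\<alpha> \<in> multi_indices d n" "\<beta> \<in> multi_indices d n'"
    and eq: "\<And>x. monomial d \<alpha> x = monomial d \<beta> x"
  shows "\<alpha> = \<beta>"
proof
  fix j
  have val: "monomial d \<gamma> ((\<lambda>_. 1)(j := 2)) = 2 ^ \<gamma> j" if "j \<in> {1..d}" for \<gamma>
  proof -
    have "monomial d \<gamma> ((\<lambda>_. 1)(j := 2)) = (\<Prod>i\<in>{1..d}. if i = j then 2 ^ \<gamma> i else 1)"
      unfolding monomial_def by (rule prod.cong) auto
    then show ?thesis using that by simp
  qed
  show "\<alpha> j = \<beta> j"
  proof (cases "j \<in> {1..d}")
    case True
    then have "(2::real) ^ \<alpha> j = 2 ^ \<beta> j" using eq[of "(\<lambda>_. 1)(j := 2)"] val by metis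
    then show ?thesis by simp
  next
    case False
    then show ?thesis using assms(1,2) unfolding multi_indices_def by simp
  qed
qed

lemma raise_mem:
  assumes "\<alpha> \<in> multi_indices d n" "u \<in> {1..d}"
  shows "raise u \<alpha> \<in> multi_indices d (n + 1)"
proof -
  have "mdeg d (raise u \<alpha>) \<le> n + 1"
    using assms(1) mdeg_raise[OF assms(2)] by (simp add: multi_indices_def)
  moreover have "raise u \<alpha> j = 0" if "j \<notin> {1..d}" for j
    using assms that by (auto simp: multi_indices_def raise_def)
  ultimately show ?thesis unfolding multi_indices_def by blast
qed

lemma phi_eq_variable_times_phi_iff:
  assumes "i \<in> {1..dim_poly d n}" "s \<in> {1..dim_poly d n}" "u \<in> {1..d}"
  shows "(\<forall>x. phi d n i x = x u * phi d n s x) \<longleftrightarrow> phi_exponent d n i = raise u (phi_exponent d n s)"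
proof
  assume "\<forall>x. phi d n i x = x u * phi d n s x"
  then show "phi_exponent d n i = raise u (phi_exponent d n s)"
    by (intro monomial_inj[OF phi_exponent_mem[OF assms(1)] raise_mem[OF phi_exponent_mem[OF assms(2)] assms(3)]])
      (simp add: phi_eq_monomial monomial_raise[OF assms(3)])
qed (simp add: phi_eq_monomial monomial_raise[OF assms(3)])

text \<open>A monomial after the first one is not constant: the constant has degree 0 and no other
  multi-index has this degree. So some variable divides it.\<close>

lemma variable_divides_phi:
  assumes i: "i \<in> {2..dim_poly d n}"
  shows "\<exists>s. s \<in> {1..dim_poly d n} \<and> (\<exists>u\<in>{1..d}. \<forall>x. phi d n i x = x u * phi d n s x)"
proof -
  have i': "i \<in> {1..dim_poly d n}" "1 \<in> {1..dim_poly d n}" using i by auto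
  let ?\<alpha> = "phi_exponent d n i"
  have "\<exists>u\<in>{1..d}. ?\<alpha> u > 0"
  proof (rule ccontr)
    assume "\<not> ?thesis"
    then have "mdeg d ?\<alpha> = 0" by (auto simp: mdeg_def)
    moreover have "grevlex_less d (phi_exponent d n 1) ?\<alpha>"
      using phi_exponent_less_iff[OF i'(2,1)] i by simp
    ultimately have "\<exists>k\<in>{1..d}. phi_exponent d n 1 k > ?\<alpha> k" "mdeg d (phi_exponent d n 1) = 0"
      by (auto simp: grevlex_less_def)
    then show False by (auto simp: mdeg_def)
  qed
  then obtain u where u: "u \<in> {1..d}" "?\<alpha> u > 0" by blast
  define \<beta> where "\<beta> = ?\<alpha>(u := ?\<alpha> u - 1)"
  have \<alpha>: "?\<alpha> = raise u \<beta>" using u by (auto simp: \<beta>_def raise_def)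
  have "mdeg d \<beta> + 1 = mdeg d ?\<alpha>" unfolding \<alpha> by (simp add: mdeg_raise[OF u(1)])
  moreover have "\<beta> j = 0" if "?\<alpha> j = 0" for j using that u(2) by (auto simp: \<beta>_def)
  moreover have "?\<alpha> j = 0" if "j \<notin> {1..d}" for j
    using phi_exponent_mem[OF i'(1)] that unfolding multi_indices_def by blast
  moreover have "mdeg d ?\<alpha> \<le> n"
    using phi_exponent_mem[OF i'(1)] unfolding multi_indices_def by blast
  ultimately have "\<beta> \<in> multi_indices d n"
    unfolding multi_indices_def by auto
  then obtain s where s: "s \<in> {1..dim_poly d n}" "\<beta> = phi_exponent d n s" by (rule phi_exponent_exists)
  then have "\<forall>x. phi d n i x = x u * phi d n s x"
    using \<alpha> by (subst phi_eq_variable_times_phi_iff[OF i'(1) s(1) u(1)]) simp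
  then show ?thesis using s(1) u(1) by blast
qed

text \<open>The cofactor of a variable has smaller degree, hence comes earlier in the list. The variable is
  unique because \<open>raise u \<beta>\<close> differs from \<open>\<beta>\<close> exactly at \<open>u\<close>.\<close>

lemma s_idx_u_idx:
  assumes i: "i \<in> {2..dim_poly d n}"
  shows "s_idx d n i \<in> {1..<i}" and "u_idx d n i \<in> {1..d}"
    and "phi_exponent d n i = raise (u_idx d n i) (phi_exponent d n (s_idx d n i))"
proof -
  have i': "i \<in> {1..dim_poly d n}" using i by auto
  let ?s = "s_idx d n i"
  have s: "?s \<in> {1..dim_poly d n}" "\<exists>u\<in>{1..d}. \<forall>x. phi d n i x = x u * phi d n ?s x"
    using LeastI_ex[OF variable_divides_phi[OF i]] unfolding s_idx_def by auto
  note iff = phi_eq_variable_times_phi_iff[OF i' s(1)]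
  obtain u where u: "u \<in> {1..d}" "phi_exponent d n i = raise u (phi_exponent d n ?s)"
    using s(2) iff by blast
  have "u_idx d n i = u"
    unfolding u_idx_def
  proof (rule the_equality)
    show "u \<in> {1..d} \<and> (\<forall>x. phi d n i x = x u * phi d n ?s x)" using u iff by blast
    fix u' assume "u' \<in> {1..d} \<and> (\<forall>x. phi d n i x = x u' * phi d n ?s x)"
    then have "raise u' (phi_exponent d n ?s) = raise u (phi_exponent d n ?s)" using u iff by metis
    then have "raise u' (phi_exponent d n ?s) u' = raise u (phi_exponent d n ?s) u'" by simp
    then show "u' = u" by (auto simp: raise_def split: if_splits)
  qed
  then show "u_idx d n i \<in> {1..d}" "phi_exponent d n i = raise (u_idx d n i) (phi_exponent d n ?s)"
    using u by auto
  have "grevlex_less d (phi_exponent d n ?s) (phi_exponent d n i)"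
    using mdeg_raise[OF u(1), of "phi_exponent d n ?s"] u(2) by (simp add: grevlex_less_def)
  then show "?s \<in> {1..<i}" using phi_exponent_less_iff[OF s(1) i'] s(1) by simp
qed

text \<open>Monotonicity of the order puts \<open>x\<^sub>u \<phi>\<^sub>k\<close> before \<open>x\<^sub>u \<phi>\<^sub>s = \<phi>\<^sub>i\<close> whenever \<open>k < s\<close>. In particular its degree
  is still at most \<open>n\<close>, so it is one of the listed monomials.\<close>

lemma earlier_products_are_earlier:
  assumes i: "i \<in> {2..dim_poly d n}" and k: "k \<in> {1..<s_idx d n i}"
  obtains k' where "k' \<in> {1..<i}" "phi_exponent d n k' = raise (u_idx d n i) (phi_exponent d n k)"
proof -
  let ?u = "u_idx d n i"
  have i': "i \<in> {1..dim_poly d n}" using i by auto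
  have s: "s_idx d n i \<in> {1..dim_poly d n}" and k': "k \<in> {1..dim_poly d n}"
    using s_idx_u_idx(1)[OF i] i k by auto
  have "grevlex_less d (phi_exponent d n k) (phi_exponent d n (s_idx d n i))"
    using phi_exponent_less_iff[OF k' s] k by simp
  then have less: "grevlex_less d (raise ?u (phi_exponent d n k)) (phi_exponent d n i)"
    using grevlex_raise[OF s_idx_u_idx(2)[OF i]] s_idx_u_idx(3)[OF i] by metis
  then have "mdeg d (raise ?u (phi_exponent d n k)) \<le> n"
    using phi_exponent_mem[OF i'] unfolding grevlex_less_def multi_indices_def by auto
  then have "raise ?u (phi_exponent d n k) \<in> multi_indices d n"
    using raise_mem[OF phi_exponent_mem[OF k'] s_idx_u_idx(2)[OF i]] by (simp add: multi_indices_def)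
  then obtain l where l: "l \<in> {1..dim_poly d n}" "raise ?u (phi_exponent d n k) = phi_exponent d n l"
    by (rule phi_exponent_exists)
  have "l < i" using less phi_exponent_less_iff[OF l(1) i'] l(2) by simp
  then show ?thesis using that[of l] l by simp
qed

section \<open>Block vectors\<close>

lemma set_blocks: "set (blocks d) = {Val} \<union> D1 ` {1..d} \<union> {D2 j k | j k. 1 \<le> j \<and> j \<le> k \<and> k \<le> d}"
proof -
  have "set (concat (map (\<lambda>j. map (D2 j) [j..<d+1]) [1..<d+1])) = (\<Union>j\<in>{1..d}. D2 j ` {j..d})"
    by (simp add: atLeastLessThanSuc_atLeastAtMost del: upt_Suc)
  moreover have "(\<Union>j\<in>{1..d}. D2 j ` {j..d}) = {D2 j k | j k. 1 \<le> j \<and> j \<le> k \<and> k \<le> d}"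
    by force
  moreover have "set (map D1 [1..<d+1]) = D1 ` {1..d}"
    by (simp add: atLeastLessThanSuc_atLeastAtMost del: upt_Suc)
  moreover have "set (blocks d) = insert Val (set (map D1 [1..<d+1]) \<union>
      set (concat (map (\<lambda>j. map (D2 j) [j..<d+1]) [1..<d+1])))"
    by (simp only: blocks_def list.set set_append)
  ultimately show ?thesis by (simp only: insert_is_Un[of Val "D1 ` A \<union> B" for A B] Un_assoc)
qed

lemma length_blocks: "length (blocks d) = dim_jet d"
proof -
  have "2 * (\<Sum>j=1..d. d + 1 - j) = d * (d + 1)"
  proof -
    \<comment> \<open>There are \<open>d + 1 - j\<close> pairs with first entry \<open>j\<close>; reversing the order gives the sum up to \<open>d\<close>.\<close>
    have "(\<Sum>j=1..d. d + 1 - j) = (\<Sum>j=1..d. j)"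
      by (rule sum.reindex_bij_witness[of _ "\<lambda>j. d + 1 - j" "\<lambda>j. d + 1 - j"]) auto
    then show ?thesis using double_gauss_sum_from_Suc_0[of d, where 'a = nat] by simp
  qed
  moreover have "sum_list (map (\<lambda>j. d + 1 - j) [1..<d+1]) = (\<Sum>j=1..d. d + 1 - j)"
    by (simp only: interv_sum_list_conv_sum_set_nat)
      (simp add: atLeastLessThanSuc_atLeastAtMost del: upt_Suc)
  ultimately show ?thesis
    by (simp add: blocks_def dim_jet_def length_concat comp_def del: upt_Suc)
qed

lemma distinct_blocks: "distinct (blocks d)"
proof -
  have "distinct (concat (map (\<lambda>j. map (D2 j) [j..<d+1]) [1..<d+1]))"
  proof (rule distinct_concat)
    have "inj_on (\<lambda>j. map (D2 j) [j..<d+1]) (set [1..<d+1])"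
    proof (rule inj_onI)
      fix i j assume *: "i \<in> set [1..<d+1]" "j \<in> set [1..<d+1]"
        "map (D2 i) [i..<d+1] = map (D2 j) [j..<d+1]"
      then have "hd (map (D2 i) [i..<d+1]) = hd (map (D2 j) [j..<d+1])" by simp
      then show "i = j" using *(1,2) by (simp add: hd_map del: upt_Suc)
    qed
    then show "distinct (map (\<lambda>j. map (D2 j) [j..<d+1]) [1..<d+1])"
      by (simp add: distinct_map del: upt_Suc)
  qed (auto simp: distinct_map inj_on_def simp del: upt_Suc)
  then show ?thesis
    by (auto simp: blocks_def distinct_map inj_on_def simp del: upt_Suc)
qed

lemma block_pos:
  assumes "b \<in> set (blocks d)"
  shows "block_pos d b < dim_jet d" and "blocks d ! block_pos d b = b"
proof -
  have "\<exists>!p. p < dim_jet d \<and> blocks d ! p = b"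
    using assms distinct_blocks[of d] unfolding length_blocks[symmetric]
    by (metis distinct_Ex1)
  from theI'[OF this] show "block_pos d b < dim_jet d" "blocks d ! block_pos d b = b"
    unfolding block_pos_def by auto
qed

lemma entry_position_less:
  fixes m D p l :: nat
  assumes "p < D" "l \<in> {1..m}"
  shows "m * p + (l - 1) < m * D"
proof -
  have "m * p + (l - 1) < m * (p + 1)" using assms(2) by auto
  also have "\<dots> \<le> m * D" using assms(1) by (intro mult_le_mono2) simp
  finally show ?thesis .
qed

lemma entry_stack:
  assumes b: "b \<in> set (blocks d)" and l: "l \<in> {1..m}"
  shows "entry d m (stack d m W) b l = W b l"
proof -
  have "l - 1 < m" using l by auto
  then have "(m * block_pos d b + (l - 1)) div m = block_pos d b"
    "(m * block_pos d b + (l - 1)) mod m = l - 1"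
    by (simp_all del: One_nat_def)
  moreover have "l - 1 + 1 = l" using l by simp
  ultimately show ?thesis
    unfolding entry_def stack_def
    using entry_position_less[OF block_pos(1)[OF b] l] block_pos(2)[OF b] by simp
qed

lemma stack_carrier: "stack d m W \<in> carrier_vec (m * dim_jet d)"
  by (simp add: stack_def)

lemma stack_cong:
  assumes "\<And>b l. \<lbrakk>b \<in> set (blocks d); l \<in> {1..m}\<rbrakk> \<Longrightarrow> V b l = W b l"
  shows "stack d m V = stack d m W"
proof (rule eq_vecI)
  fix r assume "r < dim_vec (stack d m W)"
  then have r: "r < m * dim_jet d" by (simp add: stack_def)
  then have "r div m < dim_jet d" by (simp add: less_mult_imp_div_less mult.commute)
  then have "blocks d ! (r div m) \<in> set (blocks d)" by (simp add: length_blocks)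
  moreover have "r mod m + 1 \<in> {1..m}" using r by (cases "m = 0") (auto simp: Suc_le_eq)
  ultimately show "stack d m V $ r = stack d m W $ r"
    using assms r by (simp add: stack_def)
qed (simp add: stack_def)

lemma X2_mat_carrier: "X2_mat d m x u \<in> carrier_mat (m * dim_jet d) (m * dim_jet d)"
  by (simp add: X2_mat_def)

lemma sum_unit_vec_entry:
  assumes w: "w \<in> carrier_vec (m * dim_jet d)" and b: "b \<in> set (blocks d)" and l: "l \<in> {1..m}"
  shows "(\<Sum>c\<in>{0..<m * dim_jet d}. entry d m (unit_vec (m * dim_jet d) c) b l * w $ c)
    = entry d m w b l"
proof -
  let ?p = "m * block_pos d b + (l - 1)"
  have p: "?p < m * dim_jet d" by (rule entry_position_less[OF block_pos(1)[OF b] l])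
  have "(\<Sum>c\<in>{0..<m * dim_jet d}. entry d m (unit_vec (m * dim_jet d) c) b l * w $ c)
      = (\<Sum>c\<in>{0..<m * dim_jet d}. if c = ?p then w $ ?p else 0)"
    using p by (intro sum.cong) (auto simp: entry_def unit_vec_def)
  also have "\<dots> = entry d m w b l" using p by (simp add: entry_def)
  finally show ?thesis .
qed

text \<open>The columns of the matrix are the images of the unit vectors, so this is the linearity of
  \<open>X2_map\<close> in the entries of its argument, checked block by block.\<close>

lemma X2_mat_mult_vec:
  assumes w: "w \<in> carrier_vec (m * dim_jet d)"
  shows "X2_mat d m x u *\<^sub>v w = X2_map d m x u w"
proof -
  let ?N = "m * dim_jet d"
  define F where "F v b l = (case b of
       Val \<Rightarrow> x l u * entry d m v Val l
     | D1 j \<Rightarrow> kron u j * entry d m v Val l + x l u * entry d m v (D1 j) l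
     | D2 j k \<Rightarrow> kron u j * entry d m v (D1 k) l + kron u k * entry d m v (D1 j) l
                + x l u * entry d m v (D2 j k) l)" for v b l
  have map_eq: "X2_map d m x u v = stack d m (F v)" for v
    unfolding X2_map_def by (rule stack_cong) (simp add: F_def)
  have linear: "(\<Sum>c\<in>{0..<?N}. F (unit_vec ?N c) b l * w $ c) = F w b l"
    if b: "b \<in> set (blocks d)" and l: "l \<in> {1..m}" for b l
  proof -
    note unit = sum_unit_vec_entry[OF w _ l]
    have scaled: "(\<Sum>c\<in>{0..<?N}. (a * entry d m (unit_vec ?N c) b' l) * w $ c) = a * entry d m w b' l"
      if "b' \<in> set (blocks d)" for a b'
      unfolding mult.assoc sum_distrib_left[symmetric] unit[OF that] ..
    have Val: "Val \<in> set (blocks d)" by (simp add: set_blocks)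
    show ?thesis
    proof (cases b)
      case Val
      with b show ?thesis by (simp only: F_def block.case scaled)
    next
      case (D1 j)
      with b Val show ?thesis
        by (simp only: F_def block.case distrib_right sum.distrib scaled)
    next
      case (D2 j k)
      then have "D1 j \<in> set (blocks d)" "D1 k \<in> set (blocks d)"
        using b by (auto simp: set_blocks)
      with b D2 show ?thesis
        by (simp only: F_def block.case distrib_right sum.distrib scaled)
    qed
  qed
  have "X2_mat d m x u *\<^sub>v w
      = stack d m (\<lambda>b l. \<Sum>c\<in>{0..<?N}. F (unit_vec ?N c) b l * w $ c)"
  proof (rule eq_vecI)
    fix r assume "r < dim_vec (stack d m (\<lambda>b l. \<Sum>c\<in>{0..<?N}. F (unit_vec ?N c) b l * w $ c))"
    then have r: "r < ?N" by (simp add: stack_def)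
    have coeff: "X2_mat d m x u $$ (r, c) = F (unit_vec ?N c) (blocks d ! (r div m)) (r mod m + 1)"
      if "c < ?N" for c
      unfolding X2_mat_def map_eq stack_def using r that by (simp only: index_mat prod.case index_vec)
    have "(X2_mat d m x u *\<^sub>v w) $ r = (\<Sum>c\<in>{0..<?N}. X2_mat d m x u $$ (r, c) * w $ c)"
      using r w X2_mat_carrier[of d m x u] by (simp add: scalar_prod_def)
    also have "\<dots> = (\<Sum>c\<in>{0..<?N}. F (unit_vec ?N c) (blocks d ! (r div m)) (r mod m + 1) * w $ c)"
      by (rule sum.cong) (simp_all only: atLeastLessThan_iff coeff)
    finally show "(X2_mat d m x u *\<^sub>v w) $ r
        = stack d m (\<lambda>b l. \<Sum>c\<in>{0..<?N}. F (unit_vec ?N c) b l * w $ c) $ r"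
      unfolding stack_def using r by (simp only: index_vec)
  qed (simp add: X2_mat_def stack_def)
  also have "\<dots> = stack d m (F w)" by (rule stack_cong) (rule linear)
  finally show ?thesis by (simp add: map_eq)
qed

section \<open>The product rule\<close>

lemma pderiv_at_variable_times:
  assumes "(\<lambda>y. f (x(j := y))) field_differentiable at (x j)"
  shows "pderiv_at j (\<lambda>x. x u * f x) x = kron u j * f x + x u * pderiv_at j f x"
proof -
  have f: "((\<lambda>y. f (x(j := y))) has_field_derivative pderiv_at j f x) (at (x j))"
    using assms unfolding pderiv_at_def by (simp add: field_differentiable_derivI)
  have u: "((\<lambda>y. (x(j := y)) u) has_field_derivative kron u j) (at (x j))"
    by (cases "u = j") (auto simp: kron_def)
  show ?thesis
    using DERIV_imp_deriv[OF DERIV_mult[OF u f]] by (simp add: pderiv_at_def)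
qed

text \<open>If \<open>\<alpha> j = 0\<close>, the truncated exponent \<open>\<alpha> j - 1\<close> is harmless because of the factor \<open>\<alpha> j\<close>.\<close>

lemma has_partial_derivative_monomial:
  "((\<lambda>y. monomial d \<alpha> (x(j := y))) has_field_derivative
     (if j \<in> {1..d} then \<alpha> j * monomial d (\<alpha>(j := \<alpha> j - 1)) x else 0)) (at (x j))"
proof (cases "j \<in> {1..d}")
  case False
  then have "monomial d \<alpha> (x(j := y)) = monomial d \<alpha> x" for y
    unfolding monomial_def by (intro prod.cong) auto
  then show ?thesis using False by auto
next
  case True
  define c where "c = (\<Prod>i\<in>{1..d} - {j}. x i ^ \<alpha> i)"
  have split: "monomial d \<beta> z = z j ^ \<beta> j * c"
    if "\<And>i. i \<noteq> j \<Longrightarrow> z i = x i" "\<And>i. i \<noteq> j \<Longrightarrow> \<beta> i = \<alpha> i" for \<beta> z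
  proof -
    have "monomial d \<beta> z = z j ^ \<beta> j * (\<Prod>i\<in>{1..d} - {j}. z i ^ \<beta> i)"
      unfolding monomial_def using True by (intro prod.remove) auto
    also have "(\<Prod>i\<in>{1..d} - {j}. z i ^ \<beta> i) = c"
      unfolding c_def using that by (intro prod.cong) auto
    finally show ?thesis .
  qed
  have "((\<lambda>y. y ^ \<alpha> j * c) has_field_derivative \<alpha> j * (x j ^ (\<alpha> j - 1) * c)) (at (x j))"
    by (auto intro!: derivative_eq_intros)
  then show ?thesis using True by (simp add: split)
qed

lemma pderiv_at_monomial:
  "pderiv_at j (monomial d \<alpha>) =
     (\<lambda>x. (if j \<in> {1..d} then real (\<alpha> j) else 0) * monomial d (\<alpha>(j := \<alpha> j - 1)) x)"
  using DERIV_imp_deriv[OF has_partial_derivative_monomial] by (auto simp: pderiv_at_def fun_eq_iff)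

lemma monomial_differentiable:
  "(\<lambda>y. monomial d \<alpha> (x(j := y))) field_differentiable at (x j)"
  using has_partial_derivative_monomial field_differentiable_def by blast

lemma pderiv_monomial_differentiable:
  "(\<lambda>y. pderiv_at k (monomial d \<alpha>) (x(j := y))) field_differentiable at (x j)"
  unfolding pderiv_at_monomial by (intro derivative_intros monomial_differentiable)

lemma pderiv_at_raise:
  assumes "u \<in> {1..d}"
  shows "pderiv_at j (monomial d (raise u \<alpha>)) =
     (\<lambda>x. kron u j * monomial d \<alpha> x + x u * pderiv_at j (monomial d \<alpha>) x)"
proof -
  have eq: "monomial d (raise u \<alpha>) = (\<lambda>x. x u * monomial d \<alpha> x)"
    using monomial_raise[OF assms] by blast
  show ?thesis
    unfolding eq by (intro ext pderiv_at_variable_times monomial_differentiable)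
qed

lemma pderiv_at_scaled_add:
  assumes "(\<lambda>y. f (x(j := y))) field_differentiable at (x j)"
    and "(\<lambda>y. g (x(j := y))) field_differentiable at (x j)"
  shows "pderiv_at j (\<lambda>x. c * f x + g x) x = c * pderiv_at j f x + pderiv_at j g x"
proof -
  note D = assms[THEN field_differentiable_derivI]
  show ?thesis
    unfolding pderiv_at_def by (rule DERIV_imp_deriv[OF DERIV_add[OF DERIV_cmult[OF D(1)] D(2)]])
qed

text \<open>The product rule applied twice; the term with the second derivative of \<open>x\<^sub>u\<close> vanishes.\<close>

lemma pderiv2_at_raise:
  assumes "u \<in> {1..d}"
  shows "pderiv_at j (pderiv_at k (monomial d (raise u \<alpha>))) x =
     kron u j * pderiv_at k (monomial d \<alpha>) x + kron u k * pderiv_at j (monomial d \<alpha>) x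
     + x u * pderiv_at j (pderiv_at k (monomial d \<alpha>)) x"
proof -
  let ?f = "monomial d \<alpha>"
  have "(\<lambda>y. (x(j := y)) u) field_differentiable at (x j)" by (cases "u = j") (auto intro: derivative_intros)
  then have "(\<lambda>y. (x(j := y)) u * pderiv_at k ?f (x(j := y))) field_differentiable at (x j)"
    by (intro derivative_intros pderiv_monomial_differentiable)
  then have "pderiv_at j (\<lambda>x. kron u k * ?f x + x u * pderiv_at k ?f x) x =
      kron u k * pderiv_at j ?f x + pderiv_at j (\<lambda>x. x u * pderiv_at k ?f x) x"
    by (intro pderiv_at_scaled_add monomial_differentiable)
  then show ?thesis
    using pderiv_at_variable_times[OF pderiv_monomial_differentiable[where k = k and x = x and j = j and d = d and \<alpha> = \<alpha>], of u]
    by (simp add: pderiv_at_raise[OF assms])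
qed

text \<open>The matrix implements the product rule: on the jet (values and derivatives up to order two at
  the nodes) of a function it acts as multiplication of this function by \<open>x\<^sub>u\<close>.\<close>

lemma X2_mat_v_vec:
  assumes u: "u \<in> {1..d}" and raise: "phi_exponent d n i = raise u (phi_exponent d n k)"
  shows "X2_mat d m x u *\<^sub>v v_vec d n m x k = v_vec d n m x i"
proof -
  have phi: "phi d n i = monomial d (raise u (phi_exponent d n k))" "phi d n k = monomial d (phi_exponent d n k)"
    by (simp_all add: phi_eq_monomial raise)
  have v: "v_vec d n m x k \<in> carrier_vec (m * dim_jet d)"
    unfolding v_vec_def by (rule stack_carrier)
  have "X2_map d m x u (v_vec d n m x k) = v_vec d n m x i"
    unfolding X2_map_def v_vec_def phi
  proof (rule stack_cong, goal_cases)
    case (1 b l)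
    show ?case
    proof (cases b)
      case Val
      then show ?thesis using 1 by (simp add: entry_stack monomial_raise[OF u])
    next
      case (D1 j)
      then have "Val \<in> set (blocks d)" by (simp add: set_blocks)
      then show ?thesis using 1 D1 by (simp add: entry_stack pderiv_at_raise[OF u])
    next
      case (D2 j k)
      then have "D1 j \<in> set (blocks d)" "D1 k \<in> set (blocks d)"
        using 1 by (auto simp: set_blocks)
      then show ?thesis using 1 D2 by (simp add: entry_stack pderiv2_at_raise[OF u])
    qed
  qed
  then show ?thesis by (simp add: X2_mat_mult_vec[OF v])
qed

section \<open>Gram-Schmidt for a semidefinite form\<close>

text \<open>Statements about spans are phrased as membership in every subspace that contains the
  generators. The subspaces used below are the kernel of a residual and its preimage under a matrix.\<close>

definition linear_subspace :: "nat \<Rightarrow> real vec set \<Rightarrow> bool" where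
  "linear_subspace N K \<longleftrightarrow> K \<subseteq> carrier_vec N \<and> 0\<^sub>v N \<in> K \<and>
     (\<forall>v\<in>K. \<forall>w\<in>K. v + w \<in> K) \<and> (\<forall>c. \<forall>v\<in>K. c \<cdot>\<^sub>v v \<in> K)"

lemma linear_subspace_lincomb:
  assumes K: "linear_subspace N K" and "finite A" and "\<And>k. k \<in> A \<Longrightarrow> q k \<in> K"
  shows "finsum_vec TYPE(real) N (\<lambda>k. c k \<cdot>\<^sub>v q k) A \<in> K"
  using assms(2,3)
proof (induction A)
  case empty
  then show ?case using K by (simp add: finsum_vec_empty linear_subspace_def)
next
  case (insert a A)
  have mem: "c k \<cdot>\<^sub>v q k \<in> K" if "k \<in> insert a A" for k
    using K insert.prems that unfolding linear_subspace_def by blast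
  have car: "c k \<cdot>\<^sub>v q k \<in> carrier_vec N" if "k \<in> insert a A" for k
    using K mem[OF that] unfolding linear_subspace_def by blast
  have "finsum_vec TYPE(real) N (\<lambda>k. c k \<cdot>\<^sub>v q k) (insert a A)
      = c a \<cdot>\<^sub>v q a + finsum_vec TYPE(real) N (\<lambda>k. c k \<cdot>\<^sub>v q k) A"
    using insert.hyps car by (intro finsum_vec_insert) auto
  then show ?case using mem[of a] insert K unfolding linear_subspace_def by auto
qed

lemma linear_subspace_preimage:
  assumes K: "linear_subspace N K" and M: "M \<in> carrier_mat N N"
  shows "linear_subspace N {w \<in> carrier_vec N. M *\<^sub>v w \<in> K}"
proof -
  have "M *\<^sub>v 0\<^sub>v N = 0\<^sub>v N" using M by (intro eq_vecI) auto
  then show ?thesis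
    using K M unfolding linear_subspace_def
    by (auto simp: mult_add_distrib_mat_vec[OF M] mult_mat_vec[OF M])
qed

locale psd_form =
  fixes N :: nat and G :: "real mat"
  assumes psd: "sym_psd_mat N G"
begin

lemma G_carrier: "G \<in> carrier_mat N N"
  using psd by (simp add: sym_psd_mat_def)

lemma inner_nonneg: "w \<in> carrier_vec N \<Longrightarrow> inner_G G w w \<ge> 0"
  using psd by (simp add: sym_psd_mat_def inner_G_def)

lemma inner_commute:
  assumes "v \<in> carrier_vec N" "w \<in> carrier_vec N"
  shows "inner_G G v w = inner_G G w v"
proof -
  have "transpose_mat G = G" using psd by (simp add: sym_psd_mat_def)
  then have "v \<bullet> (G *\<^sub>v w) = (G *\<^sub>v v) \<bullet> w"
    using transpose_vec_mult_scalar[OF G_carrier assms(2) assms(1)] by simp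
  then show ?thesis
    unfolding inner_G_def
    using comm_scalar_prod[OF mult_mat_vec_carrier[OF G_carrier assms(1)] assms(2)] by simp
qed

lemma inner_add:
  assumes "u \<in> carrier_vec N" "v \<in> carrier_vec N" "w \<in> carrier_vec N"
  shows "inner_G G (u + v) w = inner_G G u w + inner_G G v w"
  unfolding inner_G_def
  by (rule add_scalar_prod_distrib[OF assms(1,2) mult_mat_vec_carrier[OF G_carrier assms(3)]])

lemma inner_smult:
  assumes "v \<in> carrier_vec N" "w \<in> carrier_vec N"
  shows "inner_G G (c \<cdot>\<^sub>v v) w = c * inner_G G v w"
  unfolding inner_G_def
  by (rule smult_scalar_prod_distrib[OF assms(1) mult_mat_vec_carrier[OF G_carrier assms(2)]])

lemma inner_smult_right:
  assumes "v \<in> carrier_vec N" "w \<in> carrier_vec N"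
  shows "inner_G G v (c \<cdot>\<^sub>v w) = c * inner_G G v w"
  using inner_commute[of v "c \<cdot>\<^sub>v w"] inner_commute[of v w] inner_smult[of w v c] assms by simp

lemma inner_minus:
  assumes "u \<in> carrier_vec N" "v \<in> carrier_vec N" "w \<in> carrier_vec N"
  shows "inner_G G (u - v) w = inner_G G u w - inner_G G v w"
  unfolding inner_G_def
  by (rule minus_scalar_prod_distrib[OF assms(1,2) mult_mat_vec_carrier[OF G_carrier assms(3)]])

lemma inner_lincomb:
  assumes "finite A" and "\<And>k. k \<in> A \<Longrightarrow> q k \<in> carrier_vec N" and w: "w \<in> carrier_vec N"
  shows "inner_G G (finsum_vec TYPE(real) N (\<lambda>k. c k \<cdot>\<^sub>v q k) A) w
    = (\<Sum>k\<in>A. c k * inner_G G (q k) w)"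
  using assms(1,2)
proof (induction A)
  case empty
  have "inner_G G (0\<^sub>v N) w = 0"
    unfolding inner_G_def using mult_mat_vec_carrier[OF G_carrier w] by simp
  then show ?case by (simp add: finsum_vec_empty)
next
  case (insert a A)
  have "finsum_vec TYPE(real) N (\<lambda>k. c k \<cdot>\<^sub>v q k) (insert a A)
      = c a \<cdot>\<^sub>v q a + finsum_vec TYPE(real) N (\<lambda>k. c k \<cdot>\<^sub>v q k) A"
    using insert.hyps insert.prems by (intro finsum_vec_insert) auto
  moreover have "finsum_vec TYPE(real) N (\<lambda>k. c k \<cdot>\<^sub>v q k) A \<in> carrier_vec N"
    using insert.prems by (intro finsum_vec_closed) auto
  ultimately show ?case
    using insert w by (simp add: inner_add inner_smult)
qed

lemma norm_square: "w \<in> carrier_vec N \<Longrightarrow> norm_G G w * norm_G G w = inner_G G w w"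
  by (simp add: norm_G_def inner_nonneg)

lemma norm_nonneg: "w \<in> carrier_vec N \<Longrightarrow> norm_G G w \<ge> 0"
  by (simp add: norm_G_def inner_nonneg)

lemma normalize_carrier: "w \<in> carrier_vec N \<Longrightarrow> normalize_G G w \<in> carrier_vec N"
  by (simp add: normalize_G_def)

lemma inner_normalize:
  assumes "w \<in> carrier_vec N" and "norm_G G w \<noteq> 0"
  shows "inner_G G (normalize_G G w) (normalize_G G w) = 1"
proof -
  have "inner_G G (normalize_G G w) (normalize_G G w) = inner_G G w w / (norm_G G w * norm_G G w)"
    using assms by (simp add: normalize_G_def inner_smult inner_smult_right)
  then show ?thesis using assms by (simp add: norm_square[symmetric])
qed

lemma normalize_smult:
  assumes w: "w \<in> carrier_vec N" and c: "c > 0"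
  shows "normalize_G G (c \<cdot>\<^sub>v w) = normalize_G G w"
proof -
  have "norm_G G (c \<cdot>\<^sub>v w) = c * norm_G G w"
    using w c by (simp add: norm_G_def inner_smult inner_smult_right real_sqrt_mult
        flip: mult.assoc)
  then show ?thesis
    using c by (simp add: normalize_G_def smult_smult_assoc)
qed

lemma lincomb_carrier:
  assumes "\<And>k. k \<in> A \<Longrightarrow> q k \<in> carrier_vec N"
  shows "finsum_vec TYPE(real) N (\<lambda>k. c k \<cdot>\<^sub>v q k) A \<in> carrier_vec N"
  using assms by (intro finsum_vec_closed) auto

lemma gs_residual_carrier:
  assumes "\<And>k. k \<in> {1..<i} \<Longrightarrow> q k \<in> carrier_vec N" and "w \<in> carrier_vec N"
  shows "gs_residual G q i w \<in> carrier_vec N"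
  using assms lincomb_carrier[of "{1..<i}" q] by (simp add: gs_residual_def)

lemma gs_residual_index:
  assumes q: "\<And>k. k \<in> {1..<i} \<Longrightarrow> q k \<in> carrier_vec N" and w: "w \<in> carrier_vec N" and r: "r < N"
  shows "gs_residual G q i w $ r = w $ r - (\<Sum>k\<in>{1..<i}. inner_G G w (q k) * q k $ r)"
proof -
  let ?S = "finsum_vec TYPE(real) N (\<lambda>k. inner_G G w (q k) \<cdot>\<^sub>v q k) {1..<i}"
  have "dim_vec (q k) = N" if "k \<in> {1..<i}" for k using q[OF that] by simp
  then have entries: "(inner_G G w (q k) \<cdot>\<^sub>v q k) $ r = inner_G G w (q k) * q k $ r"
    if "k \<in> {1..<i}" for k
    using that r by simp
  have "?S $ r = (\<Sum>k\<in>{1..<i}. (inner_G G w (q k) \<cdot>\<^sub>v q k) $ r)"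
    using q r by (intro index_finsum_vec) auto
  also have "\<dots> = (\<Sum>k\<in>{1..<i}. inner_G G w (q k) * q k $ r)"
    by (intro sum.cong entries) auto
  finally show ?thesis
    using w r lincomb_carrier[of "{1..<i}" q "\<lambda>k. inner_G G w (q k)"] q
    by (simp add: gs_residual_def)
qed

lemma gs_residual_cong:
  assumes q: "\<And>k. k \<in> {1..<i} \<Longrightarrow> q k \<in> carrier_vec N" and w: "w \<in> carrier_vec N"
    and eq: "\<And>k. k \<in> {1..<i} \<Longrightarrow> p k = q k"
  shows "gs_residual G p i w = gs_residual G q i w"
proof (rule eq_vecI)
  have p: "p k \<in> carrier_vec N" if "k \<in> {1..<i}" for k
    using q[OF that] eq[OF that] by simp
  have car: "gs_residual G p i w \<in> carrier_vec N" "gs_residual G q i w \<in> carrier_vec N"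
    using p q w by (auto intro!: gs_residual_carrier)
  then show "dim_vec (gs_residual G p i w) = dim_vec (gs_residual G q i w)" by simp
  fix r assume "r < dim_vec (gs_residual G q i w)"
  then have r: "r < N" using car by simp
  have "(\<Sum>k\<in>{1..<i}. inner_G G w (p k) * p k $ r) = (\<Sum>k\<in>{1..<i}. inner_G G w (q k) * q k $ r)"
    by (rule sum.cong) (simp_all add: eq)
  then show "gs_residual G p i w $ r = gs_residual G q i w $ r"
    by (simp only: gs_residual_index[OF p w r] gs_residual_index[OF q w r])
qed

lemma gs_residual_smult:
  assumes q: "\<And>k. k \<in> {1..<i} \<Longrightarrow> q k \<in> carrier_vec N" and w: "w \<in> carrier_vec N"
  shows "gs_residual G q i (c \<cdot>\<^sub>v w) = c \<cdot>\<^sub>v gs_residual G q i w"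
proof (rule eq_vecI)
  have car: "gs_residual G q i (c \<cdot>\<^sub>v w) \<in> carrier_vec N" "gs_residual G q i w \<in> carrier_vec N"
    using assms by (auto intro!: gs_residual_carrier)
  then show "dim_vec (gs_residual G q i (c \<cdot>\<^sub>v w)) = dim_vec (c \<cdot>\<^sub>v gs_residual G q i w)"
    by simp
  fix r assume "r < dim_vec (c \<cdot>\<^sub>v gs_residual G q i w)"
  then have r: "r < N" using car by simp
  have cw: "c \<cdot>\<^sub>v w \<in> carrier_vec N" using w by simp
  have "(\<Sum>k\<in>{1..<i}. inner_G G (c \<cdot>\<^sub>v w) (q k) * q k $ r) =
      c * (\<Sum>k\<in>{1..<i}. inner_G G w (q k) * q k $ r)"
    unfolding sum_distrib_left using w q by (intro sum.cong) (simp_all add: inner_smult)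
  then show "gs_residual G q i (c \<cdot>\<^sub>v w) $ r = (c \<cdot>\<^sub>v gs_residual G q i w) $ r"
    using gs_residual_index[OF q cw r] gs_residual_index[OF q w r] r w car
    by (simp add: right_diff_distrib)
qed

lemma gs_residual_add:
  assumes q: "\<And>k. k \<in> {1..<i} \<Longrightarrow> q k \<in> carrier_vec N"
    and v: "v \<in> carrier_vec N" and w: "w \<in> carrier_vec N"
  shows "gs_residual G q i (v + w) = gs_residual G q i v + gs_residual G q i w"
proof (rule eq_vecI)
  have car: "gs_residual G q i (v + w) \<in> carrier_vec N" "gs_residual G q i v \<in> carrier_vec N"
    "gs_residual G q i w \<in> carrier_vec N"
    using assms by (auto intro!: gs_residual_carrier)
  then show "dim_vec (gs_residual G q i (v + w)) = dim_vec (gs_residual G q i v + gs_residual G q i w)"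
    by simp
  fix r assume "r < dim_vec (gs_residual G q i v + gs_residual G q i w)"
  then have r: "r < N" using car by simp
  have vw: "v + w \<in> carrier_vec N" using v w by simp
  have "(\<Sum>k\<in>{1..<i}. inner_G G (v + w) (q k) * q k $ r) =
      (\<Sum>k\<in>{1..<i}. inner_G G v (q k) * q k $ r) + (\<Sum>k\<in>{1..<i}. inner_G G w (q k) * q k $ r)"
    unfolding sum.distrib[symmetric] using v w q
    by (intro sum.cong) (simp_all add: inner_add distrib_right)
  then show "gs_residual G q i (v + w) $ r = (gs_residual G q i v + gs_residual G q i w) $ r"
    using gs_residual_index[OF q vw r] gs_residual_index[OF q v r] gs_residual_index[OF q w r]
      r v w car by simp
qed

lemma linear_subspace_gs_residual_kernel:
  assumes q: "\<And>k. k \<in> {1..<i} \<Longrightarrow> q k \<in> carrier_vec N"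
  shows "linear_subspace N {w \<in> carrier_vec N. gs_residual G q i w = 0\<^sub>v N}"
proof -
  have "gs_residual G q i (0\<^sub>v N) = 0\<^sub>v N"
  proof -
    have "gs_residual G q i (0 \<cdot>\<^sub>v 0\<^sub>v N) = 0 \<cdot>\<^sub>v gs_residual G q i (0\<^sub>v N)"
      using q by (intro gs_residual_smult) auto
    moreover have "0 \<cdot>\<^sub>v w = 0\<^sub>v N" if "w \<in> carrier_vec N" for w :: "real vec"
      using that by (intro eq_vecI) auto
    ultimately show ?thesis
      using gs_residual_carrier[of i q "0\<^sub>v N"] q by simp
  qed
  moreover have "gs_residual G q i (v + w) = gs_residual G q i v + gs_residual G q i w"
    "gs_residual G q i (c \<cdot>\<^sub>v v) = c \<cdot>\<^sub>v gs_residual G q i v"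
    if "v \<in> carrier_vec N" "w \<in> carrier_vec N" for v w c
    using q that by (intro gs_residual_add gs_residual_smult; simp)+
  moreover have "0\<^sub>v N + 0\<^sub>v N = (0\<^sub>v N :: real vec)" "c \<cdot>\<^sub>v 0\<^sub>v N = (0\<^sub>v N :: real vec)" for c
    by (intro eq_vecI; simp)+
  ultimately show ?thesis
    unfolding linear_subspace_def by auto
qed

text \<open>The part \<open>p\<close> is the projection, a linear combination of the \<open>q k\<close>, and so lies in every
  subspace that contains them.\<close>

lemma gs_residual_decomposition:
  assumes K: "linear_subspace N K" and q: "\<And>k. k \<in> {1..<i} \<Longrightarrow> q k \<in> K"
    and w: "w \<in> carrier_vec N"
  obtains p where "p \<in> K" and "w = gs_residual G q i w + p"
proof
  let ?S = "finsum_vec TYPE(real) N (\<lambda>k. inner_G G w (q k) \<cdot>\<^sub>v q k) {1..<i}"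
  show S: "?S \<in> K" using q by (intro linear_subspace_lincomb[OF K]) auto
  then have "?S \<in> carrier_vec N" using K by (auto simp: linear_subspace_def)
  then show "w = gs_residual G q i w + ?S"
    using w by (intro eq_vecI) (auto simp: gs_residual_def)
qed

lemma normalized_residual_mem_iff:
  assumes K: "linear_subspace N K" and q: "\<And>k. k \<in> {1..<i} \<Longrightarrow> q k \<in> K"
    and w: "w \<in> carrier_vec N" and nz: "norm_G G (gs_residual G q i w) \<noteq> 0"
  shows "normalize_G G (gs_residual G q i w) \<in> K \<longleftrightarrow> w \<in> K"
proof -
  let ?r = "gs_residual G q i w"
  obtain p where p: "p \<in> K" "w = ?r + p"
    using gs_residual_decomposition[where q = q, OF K q w] by blast
  have add: "v + v' \<in> K" if "v \<in> K" "v' \<in> K" for v v'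
    using K that by (simp add: linear_subspace_def)
  have scale: "c \<cdot>\<^sub>v v \<in> K" if "v \<in> K" for c v
    using K that by (simp add: linear_subspace_def)
  have qc: "q k \<in> carrier_vec N" if "k \<in> {1..<i}" for k
    using q[OF that] K by (auto simp: linear_subspace_def)
  have rc: "?r \<in> carrier_vec N" by (rule gs_residual_carrier[OF qc w])
  have pc: "p \<in> carrier_vec N" using p K by (auto simp: linear_subspace_def)
  have "?r = w + (-1) \<cdot>\<^sub>v p"
  proof (rule eq_vecI)
    fix r assume "r < dim_vec (w + (-1) \<cdot>\<^sub>v p)"
    then have "r < N" using pc by simp
    moreover have "w $ r = (?r + p) $ r" using p(2) by simp
    ultimately show "?r $ r = (w + (-1) \<cdot>\<^sub>v p) $ r" using pc by simp
  qed (use pc rc in simp)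
  then have "?r \<in> K \<longleftrightarrow> w \<in> K" using add scale p by metis
  moreover have "?r = norm_G G ?r \<cdot>\<^sub>v normalize_G G ?r"
    using nz by (simp add: normalize_G_def smult_smult_assoc)
  then have "?r \<in> K \<longleftrightarrow> normalize_G G ?r \<in> K"
    using scale unfolding normalize_G_def by metis
  ultimately show ?thesis by simp
qed

lemma gs_residual_orthogonal:
  assumes q: "\<And>k. k \<in> {1..<i} \<Longrightarrow> q k \<in> carrier_vec N"
    and orth: "\<And>k l. \<lbrakk>k \<in> {1..<i}; l \<in> {1..<i}\<rbrakk> \<Longrightarrow> inner_G G (q k) (q l) = (if k = l then 1 else 0)"
    and w: "w \<in> carrier_vec N" and j: "j \<in> {1..<i}"
  shows "inner_G G (gs_residual G q i w) (q j) = 0"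
proof -
  have "inner_G G (gs_residual G q i w) (q j) =
      inner_G G w (q j) - (\<Sum>k\<in>{1..<i}. inner_G G w (q k) * inner_G G (q k) (q j))"
    using w q[OF j] lincomb_carrier[where q = q and A = "{1..<i}", OF q]
      inner_lincomb[where q = q and A = "{1..<i}", OF _ q q[OF j]]
    by (simp add: gs_residual_def inner_minus)
  also have "(\<Sum>k\<in>{1..<i}. inner_G G w (q k) * inner_G G (q k) (q j)) =
      (\<Sum>k\<in>{1..<i}. if k = j then inner_G G w (q j) else 0)"
    using orth j by (intro sum.cong) auto
  also have "\<dots> = inner_G G w (q j)" using j by simp
  finally show ?thesis by simp
qed

text \<open>By orthonormality the projection of \<open>q j\<close> reproduces \<open>q j\<close>. The residual is thus the zero
  vector itself and not merely a vector of norm zero, which would be weaker for a singular \<open>G\<close>.\<close>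

lemma gs_residual_of_earlier:
  assumes q: "\<And>k. k \<in> {1..<i} \<Longrightarrow> q k \<in> carrier_vec N"
    and orth: "\<And>k l. \<lbrakk>k \<in> {1..<i}; l \<in> {1..<i}\<rbrakk> \<Longrightarrow> inner_G G (q k) (q l) = (if k = l then 1 else 0)"
    and j: "j \<in> {1..<i}"
  shows "gs_residual G q i (q j) = 0\<^sub>v N"
proof (rule eq_vecI)
  have car: "gs_residual G q i (q j) \<in> carrier_vec N"
    by (rule gs_residual_carrier[OF q q[OF j]])
  then show "dim_vec (gs_residual G q i (q j)) = dim_vec (0\<^sub>v N :: real vec)" by simp
  fix r assume "r < dim_vec (0\<^sub>v N :: real vec)"
  then have r: "r < N" by simp
  have "(\<Sum>k\<in>{1..<i}. inner_G G (q j) (q k) * q k $ r) =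
      (\<Sum>k\<in>{1..<i}. if k = j then q j $ r else 0)"
    using orth j by (intro sum.cong) auto
  also have "\<dots> = q j $ r" using j by simp
  finally show "gs_residual G q i (q j) $ r = 0\<^sub>v N $ r"
    using gs_residual_index[OF q q[OF j] r] r by simp
qed

definition gram_schmidt_upto :: "nat \<Rightarrow> (nat \<Rightarrow> real vec) \<Rightarrow> (nat \<Rightarrow> real vec) \<Rightarrow> bool" where
  "gram_schmidt_upto t v q \<longleftrightarrow> (\<forall>i\<in>{1..t}. v i \<in> carrier_vec N \<and>
     q i = normalize_G G (gs_residual G q i (v i)) \<and> norm_G G (gs_residual G q i (v i)) \<noteq> 0)"

lemma gram_schmidtD:
  assumes "gram_schmidt_upto t v q" "i \<in> {1..t}"
  shows "v i \<in> carrier_vec N" "q i = normalize_G G (gs_residual G q i (v i))"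
    "norm_G G (gs_residual G q i (v i)) \<noteq> 0"
  using assms unfolding gram_schmidt_upto_def by blast+

lemma gram_schmidt_carrier:
  assumes gs: "gram_schmidt_upto t v q" and "i \<in> {1..t}"
  shows "q i \<in> carrier_vec N"
  using assms(2)
proof (induction i rule: less_induct)
  case (less i)
  have "gs_residual G q i (v i) \<in> carrier_vec N"
    using less by (intro gs_residual_carrier gram_schmidtD[OF gs]) auto
  then show ?case
    using gram_schmidtD(2)[OF gs less.prems] normalize_carrier by metis
qed

lemma gram_schmidt_orthonormal:
  assumes gs: "gram_schmidt_upto t v q" and "i \<in> {1..t}" "j \<in> {1..t}"
  shows "inner_G G (q i) (q j) = (if i = j then 1 else 0)"
proof -
  have car: "q i \<in> carrier_vec N" if "i \<in> {1..t}" for i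
    by (rule gram_schmidt_carrier[OF gs that])
  have "\<forall>k\<in>{1..i}. \<forall>l\<in>{1..i}. inner_G G (q k) (q l) = (if k = l then 1 else 0)" if "i \<le> t" for i
    using that
  proof (induction i)
    case 0
    then show ?case by simp
  next
    case (Suc i)
    let ?r = "gs_residual G q (Suc i) (v (Suc i))"
    have i: "Suc i \<in> {1..t}" using Suc by simp
    have rc: "?r \<in> carrier_vec N"
      using Suc.prems car gram_schmidtD(1)[OF gs i] by (intro gs_residual_carrier) auto
    have new: "inner_G G (q (Suc i)) (q (Suc i)) = 1"
      using inner_normalize[OF rc gram_schmidtD(3)[OF gs i]] gram_schmidtD(2)[OF gs i] by simp
    have old: "inner_G G (q (Suc i)) (q j) = 0" if j: "j \<in> {1..i}" for j
    proof -
      have "inner_G G ?r (q j) = 0"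
        using Suc car gram_schmidtD(1)[OF gs i] j by (intro gs_residual_orthogonal) auto
      then have "inner_G G (normalize_G G ?r) (q j) = 0"
        using rc car[of j] j Suc.prems by (simp add: normalize_G_def inner_smult)
      then show ?thesis using gram_schmidtD(2)[OF gs i] by simp
    qed
    have old': "inner_G G (q j) (q (Suc i)) = 0" if j: "j \<in> {1..i}" for j
      using old[OF j] inner_commute[of "q j" "q (Suc i)"] car[OF i] car[of j] j Suc.prems by simp
    have "{1..Suc i} = insert (Suc i) {1..i}" by auto
    then show ?case using Suc new old old' by auto
  qed
  from this[of t] assms show ?thesis by simp
qed

text \<open>Each \<open>q k\<close> is a nonzero multiple of \<open>v k\<close> minus a combination of earlier \<open>q\<close>, so initial
  segments of both families have equal spans.\<close>

lemma gram_schmidt_span: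
  assumes gs: "gram_schmidt_upto t v q" and K: "linear_subspace N K" and "j \<le> t"
  shows "(\<forall>k\<in>{1..j}. q k \<in> K) \<longleftrightarrow> (\<forall>k\<in>{1..j}. v k \<in> K)"
  using \<open>j \<le> t\<close>
proof (induction j)
  case 0
  then show ?case by simp
next
  case (Suc j)
  have j: "Suc j \<in> {1..t}" using Suc.prems by simp
  have step: "q (Suc j) \<in> K \<longleftrightarrow> v (Suc j) \<in> K" if "\<forall>k\<in>{1..j}. q k \<in> K"
    using normalized_residual_mem_iff[OF K, of "Suc j" q "v (Suc j)"] that
      gram_schmidtD[OF gs j] by (simp add: atLeastLessThanSuc_atLeastAtMost)
  have "{1..Suc j} = insert (Suc j) {1..j}" by auto
  then show ?case using Suc step by auto
qed

text \<open>Up to a positive factor, \<open>q (s i)\<close> is \<open>v (s i)\<close> minus a combination of earlier vectors. The map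
  \<open>M i\<close> sends \<open>v (s i)\<close> to \<open>v i\<close> and, by the monotonicity assumption, the earlier vectors into the
  span of \<open>v 1, \<dots>, v (i - 1)\<close>, that is of \<open>q 1, \<dots>, q (i - 1)\<close>, where the residual vanishes.
  So \<open>M i *\<^sub>v q (s i)\<close> and \<open>v i\<close> have residuals that differ by a positive factor.\<close>

lemma gram_schmidt_recursive_generation:
  assumes gs: "gram_schmidt_upto t v q"
    and M: "\<And>i. i \<in> {2..t} \<Longrightarrow> M i \<in> carrier_mat N N"
    and s: "\<And>i. i \<in> {2..t} \<Longrightarrow> s i \<in> {1..<i}"
    and gen: "\<And>i. i \<in> {2..t} \<Longrightarrow> M i *\<^sub>v v (s i) = v i"
    and mono: "\<And>i k. \<lbrakk>i \<in> {2..t}; k \<in> {1..<s i}\<rbrakk> \<Longrightarrow> \<exists>k'\<in>{1..<i}. M i *\<^sub>v v k = v k'"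
    and p_1: "p 1 = q 1"
    and p_i: "\<And>i. i \<in> {2..t} \<Longrightarrow> p i = normalize_G G (gs_residual G p i (M i *\<^sub>v p (s i)))"
    and "i \<in> {1..t}"
  shows "p i = q i"
  using \<open>i \<in> {1..t}\<close>
proof (induction i rule: less_induct)
  case (less i)
  show ?case
  proof (cases "i = 1")
    case True
    then show ?thesis using p_1 by simp
  next
    case False
    then have i: "i \<in> {2..t}" using less.prems by auto
    have si: "s i \<in> {1..t}" "s i \<in> {1..<i}" using s[OF i] i by auto
    have car: "q k \<in> carrier_vec N" if "k \<in> {1..<i}" for k
      using gram_schmidt_carrier[OF gs] that i by simp
    \<comment> \<open>Contains \<open>q k\<close> for all \<open>k < i\<close> by orthonormality, hence also \<open>v k\<close> for these \<open>k\<close>.\<close>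
    define K where "K = {w \<in> carrier_vec N. gs_residual G q i w = 0\<^sub>v N}"
    have K: "linear_subspace N K"
      unfolding K_def by (rule linear_subspace_gs_residual_kernel[OF car])
    have "\<forall>k\<in>{1..i-1}. q k \<in> K"
    proof
      fix k assume "k \<in> {1..i-1}"
      then have k: "k \<in> {1..<i}" using i by auto
      have "gs_residual G q i (q k) = 0\<^sub>v N"
        using i gram_schmidt_orthonormal[OF gs] k
        by (intro gs_residual_of_earlier[OF car]) auto
      then show "q k \<in> K" using car[OF k] by (simp add: K_def)
    qed
    then have vK: "v k \<in> K" if "k \<in> {1..<i}" for k
      using gram_schmidt_span[OF gs K, of "i - 1"] i that by auto
    \<comment> \<open>A subspace that contains \<open>v k\<close> for all \<open>k < s i\<close>, hence also \<open>q k\<close> for these \<open>k\<close>.\<close>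
    define L where "L = {w \<in> carrier_vec N. M i *\<^sub>v w \<in> K}"
    have L: "linear_subspace N L"
      unfolding L_def by (rule linear_subspace_preimage[OF K M[OF i]])
    have "\<forall>k\<in>{1..s i - 1}. v k \<in> L"
    proof
      fix k assume k: "k \<in> {1..s i - 1}"
      then have "k \<in> {1..<s i}" by auto
      then obtain k' where "k' \<in> {1..<i}" "M i *\<^sub>v v k = v k'" using mono[OF i] by blast
      moreover have "v k \<in> carrier_vec N"
        using gram_schmidtD(1)[OF gs, of k] k si(1) by auto
      ultimately show "v k \<in> L" using vK by (simp add: L_def)
    qed
    then have "\<forall>k\<in>{1..s i - 1}. q k \<in> L"
      using gram_schmidt_span[OF gs L, of "s i - 1"] si by auto
    then have qL: "q k \<in> L" if "k \<in> {1..<s i}" for k using that by auto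
    define r where "r = gs_residual G q (s i) (v (s i))"
    define c where "c = 1 / norm_G G r"
    have vsc: "v (s i) \<in> carrier_vec N" and vic: "v i \<in> carrier_vec N"
      using gram_schmidtD(1)[OF gs] si(1) less.prems by auto
    have rc: "r \<in> carrier_vec N"
      unfolding r_def using car si by (intro gs_residual_carrier vsc) auto
    have "norm_G G r \<noteq> 0"
      unfolding r_def by (rule gram_schmidtD(3)[OF gs si(1)])
    then have c: "c > 0" using norm_nonneg[OF rc] by (simp add: c_def)
    have qs: "q (s i) = c \<cdot>\<^sub>v r"
      using gram_schmidtD(2)[OF gs si(1)] by (simp add: c_def r_def normalize_G_def)
    obtain e where e: "e \<in> L" "v (s i) = r + e"
      unfolding r_def using gs_residual_decomposition[where q = q, OF L qL vsc] by blast
    have ec: "e \<in> carrier_vec N" and Me: "M i *\<^sub>v e \<in> K" using e(1) by (auto simp: L_def)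
    have Mec: "M i *\<^sub>v e \<in> carrier_vec N" using Me by (simp add: K_def)
    have Mrc: "M i *\<^sub>v r \<in> carrier_vec N" using M[OF i] rc by simp
    have Mqc: "M i *\<^sub>v q (s i) \<in> carrier_vec N" using M[OF i] car[OF si(2)] by simp
    have "v i = M i *\<^sub>v r + M i *\<^sub>v e"
      using gen[OF i] e(2) mult_add_distrib_mat_vec[OF M[OF i] rc ec] by simp
    then have "gs_residual G q i (v i) = gs_residual G q i (M i *\<^sub>v r)"
      using gs_residual_add[OF car Mrc Mec] Me gs_residual_carrier[OF car Mrc]
      by (simp add: K_def)
    then have "gs_residual G q i (M i *\<^sub>v q (s i)) = c \<cdot>\<^sub>v gs_residual G q i (v i)"
      using gs_residual_smult[OF car Mrc] mult_mat_vec[OF M[OF i] rc] by (simp add: qs)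
    then have "normalize_G G (gs_residual G q i (M i *\<^sub>v q (s i))) = q i"
      using normalize_smult[OF gs_residual_carrier[OF car vic] c]
        gram_schmidtD(2)[OF gs less.prems] by simp
    moreover have "p k = q k" if "k \<in> {1..<i}" for k
      using less.IH[of k] that i by simp
    then have "gs_residual G p i (M i *\<^sub>v p (s i)) = gs_residual G q i (M i *\<^sub>v q (s i))"
      using gs_residual_cong[OF car Mqc] si(2) by simp
    ultimately show ?thesis using p_i[OF i] by simp
  qed
qed

end

section \<open>The two processes agree\<close>

theorem theorem3p1:
  fixes d n m t :: nat
    and x :: "nat \<Rightarrow> nat \<Rightarrow> real"
    and G :: "real mat"
    and q qh :: "nat \<Rightarrow> real vec"
  assumes "d \<ge> 1" and "n \<ge> 1" and "m \<ge> 1"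
    and "sym_psd_mat (m * dim_jet d) G"
    and "1 \<le> t" and "t \<le> dim_poly d n"
    and q_1: "q 1 = normalize_G G (v_vec d n m x 1)"
    and q_i: "\<And>i. i \<in> {2..t} \<Longrightarrow>
      q i = normalize_G G
        (gs_residual G q i (X2_mat d m x (u_idx d n i) *\<^sub>v v_vec d n m x (s_idx d n i)))"
    and no_breakdown_1: "norm_G G (v_vec d n m x 1) \<noteq> 0"
    and no_breakdown_i: "\<And>i. i \<in> {2..t} \<Longrightarrow>
      norm_G G
        (gs_residual G q i (X2_mat d m x (u_idx d n i) *\<^sub>v v_vec d n m x (s_idx d n i))) \<noteq> 0"
    and qh_1: "qh 1 = q 1"
    and qh_i: "\<And>i. i \<in> {2..t} \<Longrightarrow>
      qh i = normalize_G G
        (gs_residual G qh i (X2_mat d m x (u_idx d n i) *\<^sub>v qh (s_idx d n i)))"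
  shows "\<forall>i\<in>{1..t}. q i = qh i"
proof -
  interpret psd_form "m * dim_jet d" G
    by unfold_locales (fact \<open>sym_psd_mat (m * dim_jet d) G\<close>)
  let ?v = "v_vec d n m x"
  have v: "?v i \<in> carrier_vec (m * dim_jet d)" for i
    unfolding v_vec_def by (rule stack_carrier)
  have range: "i \<in> {2..dim_poly d n}" if "i \<in> {2..t}" for i
    using that \<open>t \<le> dim_poly d n\<close> by simp
  have gen: "X2_mat d m x (u_idx d n i) *\<^sub>v ?v (s_idx d n i) = ?v i" if "i \<in> {2..t}" for i
    by (rule X2_mat_v_vec[OF s_idx_u_idx(2,3)[OF range[OF that]]])
  have earlier: "\<exists>k'\<in>{1..<i}. X2_mat d m x (u_idx d n i) *\<^sub>v ?v k = ?v k'"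
    if i: "i \<in> {2..t}" and k: "k \<in> {1..<s_idx d n i}" for i k
  proof -
    obtain k' where "k' \<in> {1..<i}" "phi_exponent d n k' = raise (u_idx d n i) (phi_exponent d n k)"
      using earlier_products_are_earlier[OF range[OF i] k] by blast
    then show ?thesis using X2_mat_v_vec[OF s_idx_u_idx(2)[OF range[OF i]]] by blast
  qed
  have gs: "gram_schmidt_upto t ?v q"
    unfolding gram_schmidt_upto_def
  proof
    fix i assume "i \<in> {1..t}"
    then consider "i = 1" | "i \<in> {2..t}" by fastforce
    then show "?v i \<in> carrier_vec (m * dim_jet d) \<and>
        q i = normalize_G G (gs_residual G q i (?v i)) \<and> norm_G G (gs_residual G q i (?v i)) \<noteq> 0"
    proof cases
      case 1
      \<comment> \<open>Nothing is subtracted for the first vector, so the start fits the general step.\<close>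
      have "gs_residual G q 1 (?v 1) = ?v 1"
        using v[of 1] by (simp add: gs_residual_def finsum_vec_empty)
      then show ?thesis using 1 q_1 no_breakdown_1 v by simp
    next
      case 2
      then show ?thesis using q_i no_breakdown_i v gen by simp
    qed
  qed
  have "qh i = q i" if "i \<in> {1..t}" for i
    using gram_schmidt_recursive_generation[OF gs X2_mat_carrier s_idx_u_idx(1)[OF range]
        gen earlier qh_1 qh_i that] by simp
  then show ?thesis by simp
qed

end
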